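(* Let $K$ be an algebraically closed field and $\Lambda=KQ/\langle\text{all paths of length }2\rangle$, where $Q$ is the quiver with a single vertex and $r\ge 2$ distinct loops. For any integer $d\ge 2$, the number of irreducible components of $\mathbf{Rep}_d(\Lambda)$ is $$d-2\left\lceil\frac{d}{r+1}\right\rceil+1.$$
   Context: $\mathbf{Rep}_d(\Lambda)$ is the affine variety of sequences $(A_1,\dots,A_r)$ with $A_i\in\operatorname{End}_K(K^d)$ and $A_iA_j=0$ for all $i,j\in\{1,\dots,r\}$ (including $i=j$). *)

theory Defs
  imports "HOL-Analysis.Analysis" "HOL-Computational_Algebra.Polynomial"
begin

text \<open>
  A point of the affine space \<open>End(K^d)^r\<close> is an \<open>'r\<close>-indexed family of square matrices over \<open>'k\<close>
  with rows and columns indexed by \<open>'n\<close>; here \<open>r = CARD('r)\<close> and \<open>d = CARD('n)\<close>.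
  The library topology on \<^typ>\<open>'a ^ 'b\<close> is not used; the Zariski topology is introduced
  as an abstract topology.
\<close>

type_synonym ('k, 'n, 'r) matrix_tuple = "'k ^ 'n ^ 'n ^ 'r"

inductive polynomial_map :: "(('k::comm_ring_1, 'n::finite, 'r::finite) matrix_tuple \<Rightarrow> 'k) \<Rightarrow> bool" where
  const: "polynomial_map (\<lambda>A. c)"
| entry: "polynomial_map (\<lambda>A. A $ l $ i $ j)"
| add: "polynomial_map p \<Longrightarrow> polynomial_map q \<Longrightarrow> polynomial_map (\<lambda>A. p A + q A)"
| mult: "polynomial_map p \<Longrightarrow> polynomial_map q \<Longrightarrow> polynomial_map (\<lambda>A. p A * q A)"

definition zero_locus ::
  "(('k::comm_ring_1, 'n::finite, 'r::finite) matrix_tuple \<Rightarrow> 'k) set \<Rightarrow> ('k, 'n, 'r) matrix_tuple set" where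
  "zero_locus P = {A. \<forall>p\<in>P. p A = 0}"

definition zariski :: "('k::idom, 'n::finite, 'r::finite) matrix_tuple topology" where
  "zariski = topology (\<lambda>U. \<exists>P. (\<forall>p\<in>P. polynomial_map p) \<and> U = - zero_locus P)"

lemma istopology_zariski:
  "istopology (\<lambda>U :: ('k::idom, 'n::finite, 'r::finite) matrix_tuple set.
     \<exists>P. (\<forall>p\<in>P. polynomial_map p) \<and> U = - zero_locus P)"
    (is "istopology ?open")
  unfolding istopology_def
proof (intro conjI allI impI)
  fix U V :: "('k::idom, 'n::finite, 'r::finite) matrix_tuple set"
  assume "?open U" "?open V"
  then obtain P Q where
    P: "\<forall>p\<in>P. polynomial_map p" "U = - zero_locus P" and
    Q: "\<forall>q\<in>Q. polynomial_map q" "V = - zero_locus Q"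
    by blast
  let ?R = "(\<lambda>(p, q) A. p A * q A) ` (P \<times> Q)"
  have "\<forall>s\<in>?R. polynomial_map s"
    using P(1) Q(1) by (auto intro: polynomial_map.mult)
  moreover have "U \<inter> V = - zero_locus ?R"
  proof (rule set_eqI)
    fix A
    have "A \<in> - zero_locus ?R \<longleftrightarrow> (\<exists>p\<in>P. \<exists>q\<in>Q. p A * q A \<noteq> 0)"
      by (simp add: zero_locus_def)
    then show "A \<in> U \<inter> V \<longleftrightarrow> A \<in> - zero_locus ?R"
      unfolding P(2) Q(2) by (auto simp: zero_locus_def)
  qed
  ultimately show "?open (U \<inter> V)" by (intro exI[of _ ?R] conjI)
next
  fix \<U> :: "('k::idom, 'n::finite, 'r::finite) matrix_tuple set set"
  assume *: "\<forall>U\<in>\<U>. ?open U"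
  let ?R = "{p. polynomial_map p \<and> (\<forall>A. p A \<noteq> 0 \<longrightarrow> A \<in> \<Union>\<U>)}"
  have "\<Union>\<U> = - zero_locus ?R"
  proof
    show "\<Union>\<U> \<subseteq> - zero_locus ?R"
    proof
      fix A assume "A \<in> \<Union>\<U>"
      then obtain U where U: "U \<in> \<U>" "A \<in> U" by blast
      with * obtain P where P: "\<forall>p\<in>P. polynomial_map p" "U = - zero_locus P" by blast
      with U obtain p where p: "p \<in> P" "p A \<noteq> 0" by (auto simp: zero_locus_def)
      have "B \<in> U" if "p B \<noteq> 0" for B
        using that p P(2) by (auto simp: zero_locus_def)
      with p P(1) U(1) have "p \<in> ?R" by blast
      with p(2) show "A \<in> - zero_locus ?R" by (auto simp: zero_locus_def)
    qed
    show "- zero_locus ?R \<subseteq> \<Union>\<U>"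
      unfolding zero_locus_def by blast
  qed
  moreover have "\<forall>p\<in>?R. polynomial_map p" by blast
  ultimately show "?open (\<Union>\<U>)" by (intro exI[of _ ?R] conjI)
qed

lemma openin_zariski:
  "openin zariski U \<longleftrightarrow> (\<exists>P. (\<forall>p\<in>P. polynomial_map p) \<and> U = - zero_locus P)"
  unfolding zariski_def by (simp add: topology_inverse'[OF istopology_zariski])

lemma topspace_zariski [simp]: "topspace zariski = UNIV"
proof -
  have "openin zariski (UNIV :: ('k::idom, 'n::finite, 'r::finite) matrix_tuple set)"
    unfolding openin_zariski
    by (rule exI[of _ "{\<lambda>A. 1}"]) (auto simp: zero_locus_def intro: polynomial_map.const)
  then show ?thesis using openin_subset by blast
qed

lemma closedin_zariski:
  "closedin zariski C \<longleftrightarrow> (\<exists>P. (\<forall>p\<in>P. polynomial_map p) \<and> C = zero_locus P)"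
  unfolding closedin_def openin_zariski by (simp add: Compl_eq_Diff_UNIV [symmetric])

definition irreducible_in :: "'a topology \<Rightarrow> 'a set \<Rightarrow> bool" where
  "irreducible_in X S \<longleftrightarrow> S \<subseteq> topspace X \<and> S \<noteq> {} \<and>
     (\<forall>C D. closedin X C \<and> closedin X D \<and> S \<subseteq> C \<union> D \<longrightarrow> S \<subseteq> C \<or> S \<subseteq> D)"

definition irreducible_components :: "'a topology \<Rightarrow> 'a set set" where
  "irreducible_components X =
     {S. irreducible_in X S \<and> (\<forall>T. irreducible_in X T \<and> S \<subseteq> T \<longrightarrow> T = S)}"

text \<open>
  Representations on \<open>K^d\<close> of \<open>KQ/\<langle>paths of length 2\<rangle>\<close>, for \<open>Q\<close> one vertex with loops
  indexed by \<open>'r\<close>: each loop acts by a matrix, and all products of two of them vanish.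
\<close>

definition Rep :: "('k::comm_ring_1, 'n::finite, 'r::finite) matrix_tuple set" where
  "Rep = {A. \<forall>i j. A $ i ** A $ j = 0}"

end

theory Submission
  imports Defs
begin

text \<open>
  Let \<open>\<kappa>(A)\<close> be the dimension of the sum of the images of the \<open>A\<^sub>i\<close>, and \<open>d - \<rho>(A)\<close> that of the
  intersection of their kernels. All products \<open>A\<^sub>i A\<^sub>j\<close> vanish exactly if the former space is
  contained in the latter, and a \<open>k\<close>-dimensional space fits between them exactly if
  \<open>\<kappa>(A) \<le> k\<close> and \<open>\<rho>(A) \<le> d - k\<close>. The set of these \<open>A\<close> is closed, and it is irreducible because it is
  swept out by the conjugates of tuples of strictly block triangular matrices of one fixed shape.
  The inequalities \<open>\<kappa> \<le> r \<rho>\<close>, \<open>\<rho> \<le> r \<kappa>\<close> and \<open>\<kappa> + \<rho> \<le> d\<close> show that the values \<open>k\<close> with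
  \<open>m \<le> k \<le> d - m\<close>, where \<open>m = \<lceil>d / (r + 1)\<rceil>\<close>, suffice to cover the variety; for each of these \<open>k\<close>
  some tuple has \<open>\<kappa> = k\<close> and \<open>\<rho> = d - k\<close>, so none of these sets contains another one.
\<close>

section \<open>Irreducibility in the Zariski topology\<close>

text \<open>The Leibniz formula builds the determinant from entries by sums and products. The
  predicate \<open>F\<close> is left abstract because the lemma serves twice: for polynomial
  functions of one parameter and for \<open>polynomial_map\<close>.\<close>

lemma det_closed:
  fixes M :: "'a \<Rightarrow> 'k::comm_ring_1 ^ 'n ^ 'n"
  assumes const: "\<And>c. F (\<lambda>x. c)"
    and add: "\<And>f g. F f \<Longrightarrow> F g \<Longrightarrow> F (\<lambda>x. f x + g x)"
    and mult: "\<And>f g. F f \<Longrightarrow> F g \<Longrightarrow> F (\<lambda>x. f x * g x)"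
    and entries: "\<And>i j. F (\<lambda>x. M x $ i $ j)"
  shows "F (\<lambda>x. det (M x))"
proof -
  have sum: "F (\<lambda>x. \<Sum>i\<in>I. f i x)" if "finite I" "\<And>i. F (f i)" for f and I :: "('n \<Rightarrow> 'n) set"
    using that by (induction I rule: finite_induct) (simp_all add: const add)
  have prod: "F (\<lambda>x. \<Prod>i\<in>I. f i x)" if "finite I" "\<And>i. F (f i)" for f and I :: "'n set"
    using that by (induction I rule: finite_induct) (simp_all add: const mult)
  show ?thesis
    unfolding det_def by (intro sum mult prod const entries finite_permutations finite)
qed

lemma poly_range_add:
  assumes "f \<in> range poly" "g \<in> range poly"
  shows "(\<lambda>t. f t + g t) \<in> range (poly :: 'k::comm_ring_1 poly \<Rightarrow> 'k \<Rightarrow> 'k)"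
proof -
  from assms obtain p q where "f = poly p" "g = poly q" by blast
  then have "(\<lambda>t. f t + g t) = poly (p + q)" by auto
  then show ?thesis by blast
qed

lemma poly_range_mult:
  assumes "f \<in> range poly" "g \<in> range poly"
  shows "(\<lambda>t. f t * g t) \<in> range (poly :: 'k::comm_ring_1 poly \<Rightarrow> 'k \<Rightarrow> 'k)"
proof -
  from assms obtain p q where "f = poly p" "g = poly q" by blast
  then have "(\<lambda>t. f t * g t) = poly (p * q)" by auto
  then show ?thesis by blast
qed

lemma poly_range_const: "(\<lambda>t. c) \<in> range (poly :: 'k::comm_ring_1 poly \<Rightarrow> 'k \<Rightarrow> 'k)"
proof -
  have "(\<lambda>t. c) = poly [:c:]" by auto
  then show ?thesis by blast
qed

text \<open>The function is one coordinate of the straight line from \<open>a\<close> at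
  \<open>t = 0\<close> to \<open>b\<close> at \<open>t = 1\<close>.\<close>

lemma poly_range_affine: "(\<lambda>t. (1 - t) * a + t * b) \<in> range (poly :: 'k::comm_ring_1 poly \<Rightarrow> 'k \<Rightarrow> 'k)"
proof -
  have "(\<lambda>t. (1 - t) * a + t * b) = poly [:a, b - a:]" by (auto simp: algebra_simps)
  then show ?thesis by blast
qed

lemma poly_range_sum:
  assumes "\<And>i. i \<in> I \<Longrightarrow> f i \<in> range poly"
  shows "(\<lambda>t. \<Sum>i\<in>I. f i t) \<in> range (poly :: 'k::comm_ring_1 poly \<Rightarrow> 'k \<Rightarrow> 'k)"
  using assms
  by (induction I rule: infinite_finite_induct) (simp_all add: poly_range_const poly_range_add)

lemma poly_range_det:
  fixes M :: "'k::comm_ring_1 \<Rightarrow> 'k ^ 'n ^ 'n"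
  assumes "\<And>i j. (\<lambda>t. M t $ i $ j) \<in> range poly"
  shows "(\<lambda>t. det (M t)) \<in> range poly"
  by (rule det_closed[where F = "\<lambda>f. f \<in> range poly"])
    (simp_all add: assms poly_range_const poly_range_add poly_range_mult del: image_iff)

lemma polynomial_map_along_curve:
  assumes "polynomial_map p" "\<And>l i j. (\<lambda>t. \<gamma> t $ l $ i $ j) \<in> range poly"
  shows "(\<lambda>t. p (\<gamma> t)) \<in> range poly"
  using assms by (induction p) (auto intro: poly_range_const poly_range_add poly_range_mult simp del: image_iff)

lemma infinite_UNIV_alg_closed: "infinite (UNIV :: 'k::alg_closed_field set)"
proof
  assume fin: "finite (UNIV :: 'k set)"
  \<comment> \<open>Over a finite field this nonconstant polynomial would take the value 1
    everywhere.\<close>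
  define p :: "'k poly" where "p = (\<Prod>a\<in>UNIV. [:- a, 1:]) + 1"
  have "degree (\<Prod>a\<in>UNIV. [:- a, 1 :: 'k:]) = card (UNIV :: 'k set)"
    by (subst degree_prod_eq_sum_degree) auto
  moreover have "card (UNIV :: 'k set) > 0" using fin by (simp add: card_gt_0_iff)
  ultimately have "degree p > 0" by (simp add: p_def degree_add_eq_left)
  then obtain x where "poly p x = 0" using alg_closed_imp_poly_has_root by blast
  moreover have "poly p x = 1" using fin by (auto simp: p_def poly_prod)
  ultimately show False by simp
qed

text \<open>
  Polynomial curves reduce irreducibility to the fact that a product of nonzero univariate
  polynomials has a non-root.
\<close>

lemma irreducible_in_zariskiI:
  fixes S :: "('k::idom, 'n::finite, 'r::finite) matrix_tuple set"
  assumes inf: "infinite (UNIV :: 'k set)" and "S \<noteq> {}"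
    and curve: "\<And>x y. x \<in> S \<Longrightarrow> y \<in> S \<Longrightarrow> \<exists>\<gamma> \<delta>. \<gamma> 0 = x \<and> \<gamma> 1 = y \<and>
      (\<forall>l i j. (\<lambda>t. \<gamma> t $ l $ i $ j) \<in> range poly) \<and>
      \<delta> \<in> range poly \<and> \<delta> 0 \<noteq> 0 \<and> (\<forall>t. \<delta> t \<noteq> 0 \<longrightarrow> \<gamma> t \<in> S)"
  shows "irreducible_in zariski S"
  unfolding irreducible_in_def
proof (intro conjI allI impI)
  show "S \<subseteq> topspace zariski" by simp
  show "S \<noteq> {}" by fact
  fix C D assume "closedin zariski C \<and> closedin zariski D \<and> S \<subseteq> C \<union> D"
  then obtain P Q where P: "\<forall>p\<in>P. polynomial_map p" "C = zero_locus P"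
    and Q: "\<forall>p\<in>Q. polynomial_map p" "D = zero_locus Q" and sub: "S \<subseteq> C \<union> D"
    unfolding closedin_zariski by blast
  show "S \<subseteq> C \<or> S \<subseteq> D"
  proof (rule ccontr)
    assume "\<not> (S \<subseteq> C \<or> S \<subseteq> D)"
    then obtain x y p q where x: "x \<in> S" "p \<in> P" "p x \<noteq> 0" and y: "y \<in> S" "q \<in> Q" "q y \<noteq> 0"
      unfolding P(2) Q(2) zero_locus_def by blast
    obtain \<gamma> \<delta> where \<gamma>: "\<gamma> 0 = x" "\<gamma> 1 = y" "\<And>l i j. (\<lambda>t. \<gamma> t $ l $ i $ j) \<in> range poly"
      and \<delta>: "\<delta> \<in> range poly" "\<delta> 0 \<noteq> 0" "\<And>t. \<delta> t \<noteq> 0 \<Longrightarrow> \<gamma> t \<in> S"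
      using curve[OF x(1) y(1)] by blast
    obtain d where d: "\<delta> = poly d" using \<delta>(1) by blast
    obtain u where u: "(\<lambda>t. p (\<gamma> t)) = poly u"
      using polynomial_map_along_curve[of p \<gamma>] \<gamma>(3) x(2) P(1) by blast
    obtain v where v: "(\<lambda>t. q (\<gamma> t)) = poly v"
      using polynomial_map_along_curve[of q \<gamma>] \<gamma>(3) y(2) Q(1) by blast
    have "poly d 0 \<noteq> 0" using \<delta>(2) d by simp
    moreover have "poly u 0 \<noteq> 0" using fun_cong[OF u, of 0] x(3) \<gamma>(1) by simp
    moreover have "poly v 1 \<noteq> 0" using fun_cong[OF v, of 1] y(3) \<gamma>(2) by simp
    \<comment> \<open>The three factors are nonzero at the points 0, 0 and 1 respectively, so each
      is a nonzero polynomial, and over a domain so is the product. Any of its non-roots gives a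
      point of \<open>S\<close> outside both closed sets.\<close>
    ultimately have "d * u * v \<noteq> 0" by auto
    then have "finite {t. poly (d * u * v) t = 0}" by (rule poly_roots_finite)
    then obtain t where t: "poly (d * u * v) t \<noteq> 0"
      using inf by (metis (mono_tags, lifting) UNIV_I ex_new_if_finite mem_Collect_eq)
    then have "\<gamma> t \<in> S" using \<delta>(3) d by auto
    moreover have "p (\<gamma> t) \<noteq> 0" "q (\<gamma> t) \<noteq> 0"
      using t fun_cong[OF u, of t] fun_cong[OF v, of t] by auto
    then have "\<gamma> t \<notin> C \<union> D" using x(2) y(2) unfolding P(2) Q(2) zero_locus_def by blast
    ultimately show False using sub by blast
  qed
qed

lemma closedin_zariskiI:
  assumes "\<And>A. A \<notin> S \<Longrightarrow> \<exists>p. polynomial_map p \<and> (\<forall>B\<in>S. p B = 0) \<and> p A \<noteq> 0"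
  shows "closedin zariski S"
  unfolding closedin_zariski
proof (intro exI conjI)
  let ?P = "{p. polynomial_map p \<and> (\<forall>B\<in>S. p B = 0)}"
  show "\<forall>p\<in>?P. polynomial_map p" by blast
  show "S = zero_locus ?P" using assms by (fastforce simp: zero_locus_def)
qed

text \<open>Closed sets of the subspace are traces of closed sets. This allows irreducibility to be
  shown in the full affine space although the components are taken inside
  \<open>Rep\<close>.\<close>

lemma irreducible_in_subtopology:
  assumes "irreducible_in X T" "T \<subseteq> S"
  shows "irreducible_in (subtopology X S) T"
  unfolding irreducible_in_def
proof (intro conjI allI impI)
  show "T \<subseteq> topspace (subtopology X S)" "T \<noteq> {}"
    using assms by (auto simp: irreducible_in_def)
  fix C D assume "closedin (subtopology X S) C \<and> closedin (subtopology X S) D \<and> T \<subseteq> C \<union> D"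
  then obtain C' D' where "closedin X C'" "C = C' \<inter> S" "closedin X D'" "D = D' \<inter> S" "T \<subseteq> C \<union> D"
    by (auto simp: closedin_subtopology)
  moreover from this have "T \<subseteq> C' \<or> T \<subseteq> D'"
    using assms(1) unfolding irreducible_in_def by (meson Int_lower1 Un_mono subset_trans)
  ultimately show "T \<subseteq> C \<or> T \<subseteq> D" using assms(2) by blast
qed

lemma irreducible_in_subset_Union:
  assumes "finite \<C>" "irreducible_in X T" "\<And>C. C \<in> \<C> \<Longrightarrow> closedin X C" "T \<subseteq> \<Union>\<C>"
  shows "\<exists>C\<in>\<C>. T \<subseteq> C"
  using assms(1,3,4)
proof (induction \<C> rule: finite_induct)
  case empty
  with assms(2) show ?case by (auto simp: irreducible_in_def)
next
  case (insert C \<C>)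
  have "closedin X C" "closedin X (\<Union>\<C>)" "T \<subseteq> C \<union> \<Union>\<C>"
    using insert by (auto intro: closedin_Union)
  then have "T \<subseteq> C \<or> T \<subseteq> \<Union>\<C>" using assms(2) unfolding irreducible_in_def by blast
  with insert show ?case by auto
qed

text \<open>Every irreducible set lies in a single member of a finite closed cover. Hence a maximal
  one equals a member, and the antichain condition makes every member maximal.\<close>

lemma irreducible_components_eqI:
  assumes fin: "finite \<C>" and cover: "\<Union>\<C> = topspace X"
    and closed: "\<And>C. C \<in> \<C> \<Longrightarrow> closedin X C"
    and irr: "\<And>C. C \<in> \<C> \<Longrightarrow> irreducible_in X C"
    and antichain: "\<And>C D. C \<in> \<C> \<Longrightarrow> D \<in> \<C> \<Longrightarrow> C \<subseteq> D \<Longrightarrow> C = D"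
  shows "irreducible_components X = \<C>"
proof -
  have below: "\<exists>C\<in>\<C>. T \<subseteq> C" if "irreducible_in X T" for T
    using irreducible_in_subset_Union[OF fin that closed] that cover
    by (auto simp: irreducible_in_def)
  show ?thesis
  proof (intro equalityI subsetI)
    fix S assume "S \<in> irreducible_components X"
    then show "S \<in> \<C>" using below irr unfolding irreducible_components_def by blast
  next
    fix C assume C: "C \<in> \<C>"
    have "T = C" if T: "irreducible_in X T" "C \<subseteq> T" for T
    proof -
      obtain D where "D \<in> \<C>" "T \<subseteq> D" using below[OF T(1)] by blast
      with antichain[OF C] T(2) show ?thesis by blast
    qed
    with irr[OF C] show "C \<in> irreducible_components X" unfolding irreducible_components_def by blast
  qed
qed

section \<open>Linear algebra over a field\<close>

text \<open>Extend \<open>c\<close> to a basis and let \<open>- D\<close> enumerate the added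
  vectors; the resulting rows span, so the matrix is invertible. It supplies both the minors for
  closedness and the conjugating matrices of the parametrization.\<close>

lemma adapted_basis:
  fixes c :: "('k::field ^ 'n) set" and D :: "'n set"
  assumes indep: "vec.independent c" and card: "card D = card c"
  shows "\<exists>g :: 'k ^ 'n ^ 'n. det g \<noteq> 0 \<and> bij_betw (\<lambda>s. g $ s) D c"
proof -
  define B where "B = vec.extend_basis c"
  have B: "c \<subseteq> B" "vec.independent B" "vec.span B = UNIV"
    unfolding B_def using vec.extend_basis_superset vec.independent_extend_basis vec.span_extend_basis indep
    by auto
  then have finB: "finite B" using vec.finiteI_independent by blast
  have "card B = CARD('n)"
    using B vec.dim_span_eq_card_independent[OF B(2)] vec_dim_card by metis
  then have "card (- D) = card (B - c)"
    using card B(1) finB by (simp add: card_Diff_subset finite_subset Compl_eq_Diff_UNIV)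
  then obtain f2 where f2: "bij_betw f2 (- D) (B - c)"
    using finB by (meson finite finite_Diff finite_same_card_bij)
  obtain f1 where f1: "bij_betw f1 D c"
    using card B(1) finB by (meson finite finite_subset finite_same_card_bij)
  define g :: "'k ^ 'n ^ 'n" where "g = (\<chi> s. if s \<in> D then f1 s else f2 s)"
  have gD: "bij_betw (\<lambda>s. g $ s) D c"
    using f1 by (rule bij_betw_cong[THEN iffD1, rotated]) (simp add: g_def)
  have gD': "(\<lambda>s. g $ s) ` (- D) = B - c"
    using f2 by (auto simp: g_def bij_betw_def)
  have "rows g = (\<lambda>s. g $ s) ` (D \<union> - D)"
    by (auto simp: rows_def row_def)
  also have "\<dots> = B" unfolding image_Un gD' using gD B(1) by (auto simp: bij_betw_def)
  finally have "vec.span (rows g) = UNIV" using B(3) by simp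
  then have "invertible g" by (simp add: matrix_left_invertible_span_rows_gen invertible_left_inverse)
  then show ?thesis using gD invertible_det_nz by blast
qed

lemma dim_annihilator:
  fixes S :: "('k::field ^ 'n) set"
  shows "vec.dim {v. \<forall>w\<in>S. (\<Sum>i\<in>UNIV. w $ i * v $ i) = 0} + vec.dim S = CARD('n)"
    (is "vec.dim ?N + _ = _")
proof -
  obtain b where b: "b \<subseteq> S" "vec.independent b" "S \<subseteq> vec.span b" "card b = vec.dim S"
    by (rule vec.basis_exists)
  have "card b \<le> CARD('n)" using b(4) dim_subset_UNIV_cart_gen[of S] by simp
  then obtain D :: "'n set" where D: "card D = card b"
    by (metis obtain_subset_with_card_n)
  obtain g :: "'k ^ 'n ^ 'n" where g: "det g \<noteq> 0" "bij_betw (\<lambda>s. g $ s) D b"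
    using adapted_basis[OF b(2) D] by blast
  have "invertible g" using g(1) by (simp add: invertible_det_nz)
  then obtain h where h: "g ** h = mat 1" "h ** g = mat 1" by (auto simp: invertible_def)
  have sub: "vec.subspace {w. (\<Sum>i\<in>UNIV. w $ i * v $ i) = 0}" for v :: "'k ^ 'n"
    by (auto simp: vec.subspace_def distrib_right sum.distrib mult.assoc simp flip: sum_distrib_left)
  have "(\<forall>w\<in>S. (\<Sum>i\<in>UNIV. w $ i * v $ i) = 0) \<longleftrightarrow> (\<forall>w\<in>b. (\<Sum>i\<in>UNIV. w $ i * v $ i) = 0)" for v
    using vec.span_minimal[OF _ sub, of b v] b(1,3) by blast
  moreover have "b = (\<lambda>s. g $ s) ` D" using g(2) by (simp add: bij_betw_def)
  \<comment> \<open>Orthogonality to \<open>S\<close> only needs testing on the basis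
    \<open>b\<close>, whose vectors are the rows of \<open>g\<close> in \<open>D\<close>. So
    \<open>g\<close> carries the annihilator onto a coordinate subspace of dimension
    \<open>card (- D)\<close>.\<close>
  ultimately have N: "v \<in> ?N \<longleftrightarrow> (\<forall>s. s \<notin> - D \<longrightarrow> (g *v v) $ s = 0)" for v
    by (auto simp: matrix_vector_mult_def)
  have "(*v) g ` ?N = {x. \<forall>s. s \<notin> - D \<longrightarrow> x $ s = 0}" (is "?l = ?r")
  proof
    show "?l \<subseteq> ?r" using N by blast
    show "?r \<subseteq> ?l"
    proof
      fix x assume x: "x \<in> ?r"
      have "g *v (h *v x) = x" by (simp add: matrix_vector_mul_assoc h)
      with x N[of "h *v x"] show "x \<in> ?l" by (metis (mono_tags, lifting) image_iff mem_Collect_eq)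
    qed
  qed
  then have "vec.dim ((*v) g ` ?N) = card (- D)"
    using dim_substandard_cart[of "- D"] by simp
  moreover have "inj ((*v) g)"
    by (metis h(2) matrix_left_invertible_injective)
  then have "vec.dim ((*v) g ` ?N) = vec.dim ?N"
    by (intro vec.dim_image_eq) (auto intro: inj_on_subset)
  moreover have "card (- D) + card D = CARD('n)"
    by (metis Compl_partition2 card_Un_disjoint Compl_disjoint2 finite)
  ultimately show ?thesis using D b(4) by simp
qed

text \<open>The classical adjugate in the form given by Cramer's rule: column \<open>i\<close> of
  \<open>g\<close> is replaced by a standard basis vector. Its entries are visibly polynomial in
  those of \<open>g\<close>.\<close>

definition adjugate :: "'k::comm_ring_1 ^ 'n ^ 'n \<Rightarrow> 'k ^ 'n ^ 'n" where
  "adjugate g = (\<chi> i j. det (\<chi> a b. if b = i then axis j 1 $ a else g $ a $ b))"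

lemma adjugate_mult:
  fixes g :: "'k::field ^ 'n ^ 'n"
  assumes "det g \<noteq> 0"
  shows "g ** adjugate g = mat (det g)" "adjugate g ** g = mat (det g)"
proof -
  have "invertible g" using assms by (simp add: invertible_det_nz)
  then obtain h where h: "g ** h = mat 1" "h ** g = mat 1" by (auto simp: invertible_def)
  have "h *v axis j 1 = (\<chi> i. adjugate g $ i $ j / det g)" for j
    using cramer[OF assms, of "h *v axis j 1" "axis j 1"]
    by (simp add: matrix_vector_mul_assoc h adjugate_def)
  then have "adjugate g $ i $ j = det g * (h *v axis j 1) $ i" for i j
    using assms by simp
  then have *: "adjugate g $ i $ j = det g * h $ i $ j" for i j
    by (simp add: matrix_vector_mult_def axis_def if_distrib cong: if_cong)
  have "(g ** adjugate g) $ i $ j = det g * (g ** h) $ i $ j" for i j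
    by (simp add: matrix_matrix_mult_def * sum_distrib_left mult.left_commute)
  then show "g ** adjugate g = mat (det g)" by (simp add: vec_eq_iff h mat_def)
  have "(adjugate g ** g) $ i $ j = det g * (h ** g) $ i $ j" for i j
    by (simp add: matrix_matrix_mult_def * sum_distrib_left mult.assoc)
  then show "adjugate g ** g = mat (det g)" by (simp add: vec_eq_iff h mat_def)
qed

section \<open>The strata of the representation variety\<close>

text \<open>\<open>col_rank\<close> and \<open>row_rank\<close> are the numbers \<kappa> and \<rho>
  of the overview. As dimensions of spans of finite families of vectors with polynomial entries they
  admit closed upper bounds, and transposition exchanges them.\<close>

definition col_rank :: "('k::field, 'n::finite, 'r::finite) matrix_tuple \<Rightarrow> nat" where
  "col_rank A = vec.dim (range (\<lambda>(l, j). column j (A $ l)))"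

definition row_rank :: "('k::field, 'n::finite, 'r::finite) matrix_tuple \<Rightarrow> nat" where
  "row_rank A = vec.dim (range (\<lambda>(l, i). row i (A $ l)))"

definition rank_stratum :: "nat \<Rightarrow> ('k::field, 'n::finite, 'r::finite) matrix_tuple set" where
  "rank_stratum k = {A \<in> Rep. col_rank A \<le> k \<and> row_rank A \<le> CARD('n) - k}"

section \<open>Closedness of the strata\<close>

text \<open>Where the dimension exceeds \<open>k\<close>, some \<open>k + 1\<close> of the vectors
  are independent; a determinant containing them separates this point from the set.\<close>

lemma closedin_dim_le:
  fixes u :: "'i::finite \<Rightarrow> ('k::field, 'n::finite, 'r::finite) matrix_tuple \<Rightarrow> 'k ^ 'm"
  assumes poly: "\<And>i j. polynomial_map (\<lambda>A. u i A $ j)"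
  shows "closedin zariski {A. vec.dim (range (\<lambda>i. u i A)) \<le> k}"
proof (rule closedin_zariskiI)
  fix A assume "A \<notin> {A. vec.dim (range (\<lambda>i. u i A)) \<le> k}"
  then have gt: "vec.dim (range (\<lambda>i. u i A)) \<ge> Suc k" by simp
  obtain b where b: "b \<subseteq> range (\<lambda>i. u i A)" "vec.independent b"
    "range (\<lambda>i. u i A) \<subseteq> vec.span b" "card b = vec.dim (range (\<lambda>i. u i A))"
    by (rule vec.basis_exists)
  then obtain c where c: "c \<subseteq> b" "card c = Suc k"
    using gt obtain_subset_with_card_n[of "Suc k" b] by metis
  have indep: "vec.independent c" using b(2) c(1) vec.independent_mono by blast
  have "Suc k \<le> CARD('m)" using gt dim_subset_UNIV_cart_gen[of "range (\<lambda>i. u i A)"] by simp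
  then obtain D :: "'m set" where D: "card D = Suc k" by (metis obtain_subset_with_card_n)
  then obtain g :: "'k ^ 'm ^ 'm" where g: "det g \<noteq> 0" "bij_betw (\<lambda>s. g $ s) D c"
    using adapted_basis[OF indep, of D] c(2) by metis
  have "\<exists>i. g $ s = u i A" if "s \<in> D" for s
  proof -
    have "g $ s \<in> c" using g(2) that by (auto simp: bij_betw_def)
    then show ?thesis using c(1) b(1) by blast
  qed
  then have "\<forall>s\<in>D. \<exists>i. g $ s = u i A" by blast
  then obtain f where f: "\<forall>s\<in>D. g $ s = u (f s) A" by (rule bchoice[THEN exE])
  \<comment> \<open>\<open>det (M B)\<close> plays the role of a minor of size \<open>k + 1\<close>: the missing rows are filled up with constant vectors.\<close>
  define M where "M B = (\<chi> s. if s \<in> D then u (f s) B else g $ s)" for B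
  have "polynomial_map (\<lambda>B. det (M B))"
  proof (rule det_closed[where F = polynomial_map])
    show "polynomial_map (\<lambda>B. M B $ s $ j)" for s j
      by (cases "s \<in> D") (simp_all add: M_def poly polynomial_map.const)
  qed (use polynomial_map.const polynomial_map.add polynomial_map.mult in blast)+
  moreover have "det (M A) \<noteq> 0"
  proof -
    have "M A $ s = g $ s" for s using f by (simp add: M_def)
    then have "M A = g" by (simp add: vec_eq_iff)
    then show ?thesis using g(1) by simp
  qed
  moreover have "det (M B) = 0" if le: "vec.dim (range (\<lambda>i. u i B)) \<le> k" for B
  proof (rule ccontr)
    assume "det (M B) \<noteq> 0"
    then have "invertible (M B)" by (simp add: invertible_det_nz)
    then have span: "vec.span (rows (M B)) = UNIV"
      unfolding invertible_left_inverse matrix_left_invertible_span_rows_gen .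
    obtain e where e: "e \<subseteq> range (\<lambda>i. u i B)" "vec.independent e"
      "range (\<lambda>i. u i B) \<subseteq> vec.span e" "card e = vec.dim (range (\<lambda>i. u i B))"
      by (rule vec.basis_exists)
    have fine: "finite e" by (rule vec.finiteI_independent[OF e(2)])
    \<comment> \<open>The rows of \<open>M B\<close> lie in the span of \<open>e\<close>, which has
      at most \<open>k\<close> elements, and of the \<open>CARD('m) - Suc k\<close> constant rows.
      These are too few vectors to span the whole space.\<close>
    let ?E = "e \<union> (\<lambda>s. g $ s) ` (- D)"
    have "M B $ s \<in> vec.span ?E" for s
    proof (cases "s \<in> D")
      case True
      then have "M B $ s = u (f s) B" by (simp add: M_def)
      also have "u (f s) B \<in> vec.span e" by (rule subsetD[OF e(3) rangeI])
      also have "vec.span e \<subseteq> vec.span ?E" by (rule vec.span_mono[OF Un_upper1])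
      finally show ?thesis .
    next
      case False
      then have "M B $ s = g $ s" by (simp add: M_def)
      also have "g $ s \<in> ?E" using False by simp
      finally show ?thesis by (rule vec.span_base)
    qed
    then have "rows (M B) \<subseteq> vec.span ?E"
      unfolding rows_def row_def vec_lambda_eta by blast
    moreover have "finite ?E" using fine by simp
    ultimately have "vec.dim (rows (M B)) \<le> card ?E"
      by (rule vec.dim_le_card)
    also have "\<dots> \<le> card e + card ((\<lambda>s. g $ s) ` (- D))" by (rule card_Un_le)
    also have "\<dots> \<le> k + card (- D)" using le e(4) by (intro add_mono card_image_le; simp)
    also have "card (- D) = CARD('m) - Suc k" using D by (simp add: Compl_eq_Diff_UNIV card_Diff_subset)
    also have "k + (CARD('m) - Suc k) < CARD('m)" using \<open>Suc k \<le> CARD('m)\<close> by simp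
    finally have "vec.dim (rows (M B)) < CARD('m)" .
    moreover have "vec.dim (rows (M B)) = CARD('m)"
      using span vec.dim_span[of "rows (M B)"] by (metis vec_dim_card)
    ultimately show False by simp
  qed
  ultimately show "\<exists>p. polynomial_map p \<and> (\<forall>B\<in>{A. vec.dim (range (\<lambda>i. u i A)) \<le> k}. p B = 0) \<and> p A \<noteq> 0"
    by blast
qed

lemma polynomial_map_sum:
  assumes "finite I" "\<And>i. polynomial_map (f i)"
  shows "polynomial_map (\<lambda>A. \<Sum>i\<in>I. f i A)"
  using assms by (induction I rule: finite_induct) (simp_all add: polynomial_map.const polynomial_map.add)

lemma closedin_Rep:
  "closedin zariski (Rep :: ('k::idom, 'n::finite, 'r::finite) matrix_tuple set)"
proof (rule closedin_zariskiI)
  fix A :: "('k, 'n, 'r) matrix_tuple"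
  assume "A \<notin> Rep"
  then obtain l m i j where ne: "(A $ l ** A $ m) $ i $ j \<noteq> 0"
    by (auto simp: Rep_def vec_eq_iff)
  let ?p = "\<lambda>A :: ('k, 'n, 'r) matrix_tuple. (A $ l ** A $ m) $ i $ j"
  have "polynomial_map ?p"
    unfolding matrix_matrix_mult_def vec_lambda_beta
    by (intro polynomial_map_sum polynomial_map.mult polynomial_map.entry) simp
  moreover have "\<forall>B\<in>Rep. ?p B = 0" by (simp add: Rep_def)
  ultimately show "\<exists>p. polynomial_map p \<and> (\<forall>B\<in>Rep. p B = 0) \<and> p A \<noteq> 0" using ne by blast
qed

lemma closedin_rank_stratum:
  "closedin zariski (rank_stratum k :: ('k::field, 'n::finite, 'r::finite) matrix_tuple set)"
proof -
  have cols: "closedin zariski {A :: ('k, 'n, 'r) matrix_tuple. col_rank A \<le> k}"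
    unfolding col_rank_def
    by (rule closedin_dim_le) (simp add: case_prod_beta column_def polynomial_map.entry)
  have rows: "closedin zariski {A :: ('k, 'n, 'r) matrix_tuple. row_rank A \<le> CARD('n) - k}"
    unfolding row_rank_def
    by (rule closedin_dim_le) (simp add: case_prod_beta row_def polynomial_map.entry)
  have "rank_stratum k = Rep \<inter> {A :: ('k, 'n, 'r) matrix_tuple. col_rank A \<le> k}
      \<inter> {A. row_rank A \<le> CARD('n) - k}"
    by (auto simp: rank_stratum_def)
  then show ?thesis using closedin_Int[OF closedin_Int[OF closedin_Rep cols] rows] by simp
qed

section \<open>Inequalities between the two ranks\<close>

text \<open>
  A basis \<open>b\<close> of the joint row space writes each \<open>A\<^sub>l\<close> as \<open>\<Sum>w\<in>b. u\<^sub>l\<^sub>w w\<^sup>T\<close>, and the vectors \<open>u\<^sub>l\<^sub>w\<close> span all columns.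
\<close>

lemma col_rank_le_mult_row_rank:
  fixes A :: "('k::field, 'n::finite, 'r::finite) matrix_tuple"
  shows "col_rank A \<le> CARD('r) * row_rank A"
proof -
  obtain b where b: "b \<subseteq> range (\<lambda>(l, i). row i (A $ l))" "vec.independent b"
    "range (\<lambda>(l, i). row i (A $ l)) \<subseteq> vec.span b" "card b = row_rank A"
    unfolding row_rank_def by (rule vec.basis_exists)
  have fin: "finite b" by (rule vec.finiteI_independent[OF b(2)])
  have "\<exists>c. row i (A $ l) = (\<Sum>w\<in>b. c w *s w)" for l i
  proof -
    have "row i (A $ l) \<in> vec.span b" using b(3) by auto
    then show ?thesis unfolding vec.span_finite[OF fin] by blast
  qed
  then have ex: "\<exists>c. row i (A $ l) = (\<Sum>w\<in>b. c w *s w)" for l i .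
  define c where "c l i = (SOME c. row i (A $ l) = (\<Sum>w\<in>b. c w *s w))" for l i
  have c: "row i (A $ l) = (\<Sum>w\<in>b. c l i w *s w)" for l i
    unfolding c_def by (rule someI_ex[OF ex])
  define U where "U = (\<lambda>(l, w). \<chi> i. c l i w) ` (UNIV \<times> b)"
  have "column j (A $ l) = (\<Sum>w\<in>b. w $ j *s (\<chi> i. c l i w))" for l j
  proof -
    have "A $ l $ i $ j = (\<Sum>w\<in>b. w $ j * c l i w)" for i
    proof -
      have "A $ l $ i $ j = row i (A $ l) $ j" by (simp add: row_def)
      also have "\<dots> = (\<Sum>w\<in>b. c l i w *s w) $ j" by (simp only: c)
      finally show ?thesis by (simp add: mult.commute)
    qed
    then show ?thesis by (simp add: vec_eq_iff column_def)
  qed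
  moreover have "(\<chi> i. c l i w) \<in> vec.span U" if "w \<in> b" for l w
    unfolding U_def using that by (intro vec.span_base) force
  ultimately have "column j (A $ l) \<in> vec.span U" for l j
    by (simp only:) (intro vec.span_sum vec.span_scale)
  then have "range (\<lambda>(l, j). column j (A $ l)) \<subseteq> vec.span U" by auto
  moreover have "finite U" unfolding U_def using fin by simp
  ultimately have "col_rank A \<le> card U"
    unfolding col_rank_def by (rule vec.dim_le_card)
  also have "\<dots> \<le> CARD('r) * row_rank A"
    using card_image_le[of "(UNIV :: 'r set) \<times> b" "\<lambda>(l, w). \<chi> i. c l i w"] fin b(4)
    by (simp add: U_def card_cartesian_product)
  finally show ?thesis .
qed

text \<open>Transposing all matrices exchanges the two ranks.\<close>

lemma row_rank_le_mult_col_rank: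
  fixes A :: "('k::field, 'n::finite, 'r::finite) matrix_tuple"
  shows "row_rank A \<le> CARD('r) * col_rank A"
  using col_rank_le_mult_row_rank[of "\<chi> l. transpose (A $ l)"]
  by (simp add: col_rank_def row_rank_def)

definition common_kernel :: "('k::field, 'n::finite, 'r::finite) matrix_tuple \<Rightarrow> ('k ^ 'n) set" where
  "common_kernel A = {v. \<forall>l. A $ l *v v = 0}"

text \<open>The common kernel is the annihilator of the joint row space.\<close>

lemma dim_common_kernel:
  fixes A :: "('k::field, 'n::finite, 'r::finite) matrix_tuple"
  shows "vec.dim (common_kernel A) + row_rank A = CARD('n)"
proof -
  have "common_kernel A = {v. \<forall>w\<in>range (\<lambda>(l, i). row i (A $ l)). (\<Sum>j\<in>UNIV. w $ j * v $ j) = 0}"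
    by (auto simp: common_kernel_def matrix_vector_mult_def vec_eq_iff row_def)
  then show ?thesis unfolding row_rank_def by (simp only: dim_annihilator)
qed

lemma column_matrix_mult: "column j (A ** B) = A *v column j (B :: 'k::comm_ring_1 ^ 'n ^ 'm)"
  by (simp add: vec_eq_iff column_def matrix_matrix_mult_def matrix_vector_mult_def)

lemma columns_in_common_kernel:
  assumes "A \<in> Rep"
  shows "range (\<lambda>(l, j). column j (A $ l)) \<subseteq> common_kernel A"
proof -
  have "A $ m *v column j (A $ l) = 0" for m l j
  proof -
    have "A $ m *v column j (A $ l) = column j (A $ m ** A $ l)"
      by (rule column_matrix_mult[symmetric])
    also have "\<dots> = 0" using assms by (simp add: Rep_def column_def vec_eq_iff)
    finally show ?thesis .
  qed
  then show ?thesis by (auto simp: common_kernel_def)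
qed

lemma col_rank_add_row_rank_le:
  fixes A :: "('k::field, 'n::finite, 'r::finite) matrix_tuple"
  assumes "A \<in> Rep"
  shows "col_rank A + row_rank A \<le> CARD('n)"
  using dim_common_kernel[of A] vec.dim_subset[OF columns_in_common_kernel[OF assms]]
  by (simp add: col_rank_def)

section \<open>Parametrization and irreducibility of the strata\<close>

lemma mat_mult_left: "(mat c ** Y) $ i $ j = c * Y $ i $ j" for Y :: "'k::comm_ring_1 ^ 'm ^ 'n"
  by (simp add: matrix_matrix_mult_def mat_def if_distrib[of "\<lambda>x. x * _"] cong: if_cong)

lemma mat_mult_right: "(Y ** mat c) $ i $ j = Y $ i $ j * c" for Y :: "'k::comm_ring_1 ^ 'm ^ 'n"
  by (simp add: matrix_matrix_mult_def mat_def if_distrib[of "\<lambda>x. _ * x"] cong: if_cong)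

lemma mat_commute: "mat c ** Y = Y ** mat c" for Y :: "'k::comm_ring_1 ^ 'n ^ 'n"
  by (simp add: vec_eq_iff mat_mult_left mat_mult_right mult.commute)

text \<open>The coordinate subspace belonging to \<open>D\<close> contains all images and is killed
  by every matrix: this is the strictly block triangular shape.\<close>

definition block_supported :: "'n set \<Rightarrow> ('k::comm_ring_1, 'n::finite, 'r::finite) matrix_tuple \<Rightarrow> bool" where
  "block_supported D X \<longleftrightarrow> (\<forall>l i j. i \<notin> D \<or> j \<in> D \<longrightarrow> X $ l $ i $ j = 0)"

text \<open>In a product of two members the middle factor \<open>h ** g\<close> is scalar, so the
  block shape makes the product vanish. All columns lie in the span of the columns of
  \<open>g\<close> in \<open>D\<close>, all rows in the span of the rows of \<open>h\<close> outside
  \<open>D\<close>. The scalar \<open>c\<close> is kept general to allow the adjugate as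
  \<open>h\<close>.\<close>

lemma rank_stratumI:
  fixes X :: "('k::field, 'n::finite, 'r::finite) matrix_tuple" and g h :: "'k ^ 'n ^ 'n"
  assumes X: "block_supported D X" and hg: "h ** g = mat c"
  shows "(\<chi> l. g ** X $ l ** h) \<in> rank_stratum (card D)"
proof -
  let ?A = "\<chi> l. g ** X $ l ** h"
  have "X $ l ** (mat c ** X $ m) = 0" for l m
  proof -
    have "X $ l $ i $ a * (c * X $ m $ a $ j) = 0" for i a j
      using X by (cases "a \<in> D") (auto simp: block_supported_def)
    then have "(\<Sum>a\<in>UNIV. X $ l $ i $ a * (c * X $ m $ a $ j)) = 0" for i j
      by (intro sum.neutral) blast
    then show ?thesis by (simp add: vec_eq_iff matrix_matrix_mult_def[of "X $ l"] mat_mult_left)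
  qed
  moreover have "?A $ l ** ?A $ m = g ** (X $ l ** (h ** g ** X $ m)) ** h" for l m
    by (simp add: matrix_mul_assoc)
  ultimately have "?A \<in> Rep" by (simp add: Rep_def hg)
  moreover have "col_rank ?A \<le> card D"
  proof -
    let ?c = "(\<lambda>a. column a g) ` D"
    have "column j (?A $ l) \<in> vec.span ?c" for l j
    proof -
      let ?v = "X $ l *v column j h"
      have "?v $ a = 0" if "a \<notin> D" for a
        using X that by (simp add: block_supported_def matrix_vector_mult_def)
      then have "?v $ a *s column a g \<in> vec.span ?c" for a
        by (cases "a \<in> D") (simp_all add: vec.span_scale vec.span_base vec.span_zero)
      then have "(\<Sum>a\<in>UNIV. ?v $ a *s column a g) \<in> vec.span ?c" by (intro vec.span_sum)
      then have "g *v ?v \<in> vec.span ?c" unfolding matrix_mult_sum .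
      then show ?thesis by (simp add: column_matrix_mult matrix_vector_mul_assoc)
    qed
    then have "range (\<lambda>(l, j). column j (?A $ l)) \<subseteq> vec.span ?c" by auto
    then have "col_rank ?A \<le> card ?c" unfolding col_rank_def by (intro vec.dim_le_card) simp_all
    also have "\<dots> \<le> card D" by (intro card_image_le) simp
    finally show ?thesis .
  qed
  moreover have "row_rank ?A \<le> CARD('n) - card D"
  proof -
    let ?c = "(\<lambda>a. row a h) ` (- D)"
    have "row i (?A $ l) \<in> vec.span ?c" for l i
    proof -
      let ?v = "row i (g ** X $ l)"
      have "?v $ a = 0" if "a \<in> D" for a
        using X that by (simp add: block_supported_def matrix_matrix_mult_def row_def)
      then have "?v $ a *s row a h \<in> vec.span ?c" for a
        by (cases "a \<in> D") (simp_all add: vec.span_scale vec.span_base vec.span_zero)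
      then have "(\<Sum>a\<in>UNIV. ?v $ a *s row a h) \<in> vec.span ?c" by (intro vec.span_sum)
      moreover have "row i (?A $ l) = (\<Sum>a\<in>UNIV. ?v $ a *s row a h)"
        by (simp add: vec_eq_iff row_def matrix_matrix_mult_def[of "g ** X $ l" h])
      ultimately show ?thesis by simp
    qed
    then have "range (\<lambda>(l, i). row i (?A $ l)) \<subseteq> vec.span ?c" by auto
    then have "row_rank ?A \<le> card ?c" unfolding row_rank_def by (intro vec.dim_le_card) simp_all
    also have "\<dots> \<le> card (- D)" by (intro card_image_le) simp
    also have "\<dots> = CARD('n) - card D" by (simp add: Compl_eq_Diff_UNIV card_Diff_subset)
    finally show ?thesis .
  qed
  ultimately show ?thesis by (simp add: rank_stratum_def)
qed

text \<open>
  With the adjugate in place of the inverse, the parametrization is polynomial in \<open>g\<close> and \<open>X\<close>; the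
  factor \<open>det g\<close> is absorbed into \<open>X\<close>.
\<close>

lemma rank_stratumE:
  fixes A :: "('k::field, 'n::finite, 'r::finite) matrix_tuple" and D :: "'n set"
  assumes "A \<in> rank_stratum (card D)"
  obtains g X where "det g \<noteq> 0" "block_supported D X" "A = (\<chi> l. g ** X $ l ** adjugate g)"
proof -
  let ?cols = "range (\<lambda>(l, j). column j (A $ l))"
  have A: "A \<in> Rep" "col_rank A \<le> card D" "row_rank A \<le> CARD('n) - card D"
    using assms by (auto simp: rank_stratum_def)
  have "card D \<le> CARD('n)" by (intro card_mono) auto
  then have dimN: "card D \<le> vec.dim (common_kernel A)" using dim_common_kernel[of A] A(3) by linarith
  obtain b where b: "b \<subseteq> ?cols" "vec.independent b" "?cols \<subseteq> vec.span b" "card b = vec.dim ?cols"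
    by (rule vec.basis_exists)
  have "b \<subseteq> common_kernel A" using b(1) columns_in_common_kernel[OF A(1)] by (rule subset_trans)
  then obtain b' where b': "b \<subseteq> b'" "b' \<subseteq> common_kernel A" "vec.independent b'"
    "common_kernel A \<subseteq> vec.span b'"
    using b(2) by (rule vec.maximal_independent_subset_extend)
  have "card b' = vec.dim (common_kernel A)" by (rule vec.basis_card_eq_dim[OF b'(2,4,3)])
  moreover have "finite b'" by (rule vec.finiteI_independent[OF b'(3)])
  moreover have "card b \<le> card D" using A(2) b(4) by (simp add: col_rank_def)
  \<comment> \<open>Here \<open>b\<close> is a basis of the sum of the images and \<open>b'\<close>
    extends it to a basis of the common kernel. The span of \<open>c\<close> is the space of
    dimension \<open>card D\<close> fitting between them.\<close>
  ultimately obtain c where c: "b \<subseteq> c" "c \<subseteq> b'" "card c = card D"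
    using exists_subset_between[of b "card D" b'] b'(1) dimN by metis
  have "vec.independent c" by (rule vec.independent_mono[OF b'(3) c(2)])
  then obtain g' :: "'k ^ 'n ^ 'n" where g': "det g' \<noteq> 0" "bij_betw (\<lambda>s. g' $ s) D c"
    using adapted_basis c(3)[symmetric] by blast
  define g where "g = transpose g'"
  have g: "det g \<noteq> 0" "(\<lambda>s. column s g) ` D = c"
    using g' by (simp_all add: g_def bij_betw_def row_def)
  then obtain h where h: "g ** h = mat 1" "h ** g = mat 1"
    using invertible_det_nz[of g] by (auto simp: invertible_def)
  define X :: "('k, 'n, 'r) matrix_tuple" where "X = (\<chi> l. mat (1 / det g) ** (h ** A $ l ** g))"
  have "(h ** A $ l ** g) $ i $ j = 0" if "i \<notin> D \<or> j \<in> D" for l i j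
  proof -
    have eq: "(h ** A $ l ** g) $ i $ j = (h *v (A $ l *v column j g)) $ i"
    proof -
      have "(h ** A $ l ** g) $ i $ j = column j (h ** A $ l ** g) $ i" by (simp add: column_def)
      then show ?thesis by (simp add: column_matrix_mult matrix_vector_mul_assoc)
    qed
    show ?thesis
    proof (cases "j \<in> D")
      case True
      then have "column j g \<in> common_kernel A" using g(2) c(2) b'(2) by blast
      then show ?thesis by (simp add: eq common_kernel_def)
    next
      case False
      then have i: "i \<notin> D" using that by blast
      \<comment> \<open>All images lie in the span of \<open>c\<close>, whose elements are the
        columns of \<open>g\<close> in \<open>D\<close>; \<open>h\<close> sends these to standard
        basis vectors with zero coordinate \<open>i\<close>.\<close>
      have "column m (A $ l) \<in> vec.span c" for m
        using b(3) vec.span_mono[OF c(1)] by fast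
      then have "(\<Sum>m\<in>UNIV. column j g $ m *s column m (A $ l)) \<in> vec.span c"
        by (intro vec.span_sum vec.span_scale)
      then have "A $ l *v column j g \<in> vec.span c" unfolding matrix_mult_sum .
      moreover have "vec.subspace {w. (h *v w) $ i = 0}"
        by (simp add: vec.subspace_def vec.add vec.scale)
      moreover have "c \<subseteq> {w. (h *v w) $ i = 0}"
      proof
        fix w assume "w \<in> c"
        then obtain s where s: "s \<in> D" "w = column s g" using g(2) by blast
        then have "h *v w = column s (mat 1)" by (simp add: h column_matrix_mult[symmetric])
        then show "w \<in> {w. (h *v w) $ i = 0}" using i s(1) by (auto simp: column_def mat_def)
      qed
      ultimately show ?thesis unfolding eq using vec.span_minimal by blast
    qed
  qed
  then have "block_supported D X" by (simp add: block_supported_def X_def mat_mult_left)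
  moreover have "g ** X $ l ** adjugate g = A $ l" for l
  proof -
    have "g ** X $ l ** adjugate g = (g ** mat (1 / det g)) ** h ** A $ l ** (g ** adjugate g)"
      by (simp add: X_def matrix_mul_assoc)
    also have "\<dots> = mat (1 / det g) ** (g ** h) ** A $ l ** mat (det g)"
      by (simp only: adjugate_mult[OF g(1)] mat_commute[of _ g, symmetric] matrix_mul_assoc)
    also have "\<dots> = A $ l" using g(1) by (simp add: h vec_eq_iff mat_mult_right mat_mult_left)
    finally show ?thesis .
  qed
  then have "A = (\<chi> l. g ** X $ l ** adjugate g)" by (simp add: vec_eq_iff)
  ultimately show thesis using that g(1) by blast
qed

text \<open>Two points are joined by interpolating their parameters \<open>g\<close> and
  \<open>X\<close> linearly. The curve stays in the stratum wherever \<open>det (G t)\<close> is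
  nonzero, so this determinant serves as \<delta>.\<close>

lemma irreducible_rank_stratum:
  fixes D :: "'n::finite set"
  assumes "infinite (UNIV :: 'k::field set)"
  shows "irreducible_in zariski (rank_stratum (card D) :: ('k, 'n, 'r::finite) matrix_tuple set)"
proof (rule irreducible_in_zariskiI[OF assms])
  have "block_supported D (0 :: ('k, 'n, 'r) matrix_tuple)" by (simp add: block_supported_def)
  then show "(rank_stratum (card D) :: ('k, 'n, 'r) matrix_tuple set) \<noteq> {}"
    using rank_stratumI[of D 0 "mat 1" "mat 1" 1] by auto
  fix x y :: "('k, 'n, 'r) matrix_tuple"
  assume "x \<in> rank_stratum (card D)" "y \<in> rank_stratum (card D)"
  then obtain g X g' X' where x: "det g \<noteq> 0" "block_supported D X" "x = (\<chi> l. g ** X $ l ** adjugate g)"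
    and y: "det g' \<noteq> 0" "block_supported D X'" "y = (\<chi> l. g' ** X' $ l ** adjugate g')"
    by (metis rank_stratumE)
  define G where "G t = (\<chi> i j. (1 - t) * g $ i $ j + t * g' $ i $ j)" for t
  define Z where "Z t = (\<chi> l i j. (1 - t) * X $ l $ i $ j + t * X' $ l $ i $ j)" for t
  define \<gamma> where "\<gamma> t = (\<chi> l. G t ** Z t $ l ** adjugate (G t))" for t
  have "G 0 = g" "G 1 = g'" "Z 0 = X" "Z 1 = X'" by (simp_all add: G_def Z_def vec_eq_iff)
  then have ends: "\<gamma> 0 = x" "\<gamma> 1 = y" "det (G 0) \<noteq> 0" using x y by (simp_all add: \<gamma>_def)
  have G: "(\<lambda>t. G t $ i $ j) \<in> range poly" for i j
    unfolding G_def vec_lambda_beta by (rule poly_range_affine)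
  have Z: "(\<lambda>t. Z t $ l $ i $ j) \<in> range poly" for l i j
    unfolding Z_def vec_lambda_beta by (rule poly_range_affine)
  have "(\<lambda>t. (if b = i then axis j 1 $ a else G t $ a $ b)) \<in> range poly" for i j a b
    by (cases "b = i") (simp_all add: poly_range_const G del: image_iff)
  then have adj: "(\<lambda>t. adjugate (G t) $ i $ j) \<in> range poly" for i j
    unfolding adjugate_def vec_lambda_beta by (intro poly_range_det) (simp only: vec_lambda_beta)
  have "(\<lambda>t. \<gamma> t $ l $ i $ j) \<in> range poly" for l i j
    unfolding \<gamma>_def vec_lambda_beta matrix_matrix_mult_def
    by (intro poly_range_sum poly_range_mult G Z adj)
  moreover have "(\<lambda>t. det (G t)) \<in> range poly" by (rule poly_range_det) (rule G)
  moreover have "\<gamma> t \<in> rank_stratum (card D)" if "det (G t) \<noteq> 0" for t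
  proof -
    have "block_supported D (Z t)" using x(2) y(2) by (simp add: block_supported_def Z_def)
    then show ?thesis unfolding \<gamma>_def using adjugate_mult(2)[OF that] by (rule rank_stratumI)
  qed
  ultimately show "\<exists>\<gamma> \<delta>. \<gamma> 0 = x \<and> \<gamma> 1 = y \<and> (\<forall>l i j. (\<lambda>t. \<gamma> t $ l $ i $ j) \<in> range poly) \<and>
      \<delta> \<in> range poly \<and> \<delta> 0 \<noteq> 0 \<and> (\<forall>t. \<delta> t \<noteq> 0 \<longrightarrow> \<gamma> t \<in> rank_stratum (card D))"
    using ends by (intro exI[of _ \<gamma>] exI[of _ "\<lambda>t. det (G t)"] conjI allI impI)
qed

section \<open>Tuples attaining both rank bounds\<close>

text \<open>
  The 0/1 matrices of such a family have every \<open>axis a 1\<close> with \<open>a \<in> D\<close> among their columns and every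
  \<open>axis b 1\<close> with \<open>b \<in> D'\<close> among their rows.
\<close>

definition matching_family :: "'a set \<Rightarrow> 'b set \<Rightarrow> ('r \<Rightarrow> 'a \<Rightarrow> 'b \<Rightarrow> bool) \<Rightarrow> bool" where
  "matching_family D D' E \<longleftrightarrow> (\<forall>l a b. E l a b \<longrightarrow> a \<in> D \<and> b \<in> D') \<and>
    (\<forall>a\<in>D. \<exists>l b. \<forall>a'. E l a' b \<longleftrightarrow> a' = a) \<and> (\<forall>b\<in>D'. \<exists>l a. \<forall>b'. E l a b' \<longleftrightarrow> b' = b)"

lemma matching_family_swap:
  assumes "matching_family D D' E"
  shows "matching_family D' D (\<lambda>l a b. E l b a)"
  using assms by (simp add: matching_family_def)

lemma exists_matching_family:
  fixes D :: "'a set" and D' :: "'b set"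
  assumes fin: "finite D" "finite D'"
    and le: "card D \<le> card D'" "card D' \<le> CARD('r::finite) * card D"
  shows "\<exists>E :: 'r \<Rightarrow> 'a \<Rightarrow> 'b \<Rightarrow> bool. matching_family D D' E"
proof -
  fix l0 :: 'r
  have "card ({l0} \<times> D) \<le> card D'" "card D' \<le> card ((UNIV :: 'r set) \<times> D)"
    using le by (simp_all add: card_cartesian_product)
  moreover have "{l0} \<times> D \<subseteq> UNIV \<times> D" by blast
  \<comment> \<open>Pairs in \<open>S\<close> are positions (matrix, row), one for each column in
    \<open>D'\<close>. Containing \<open>{l0} \<times> D\<close> makes every \<open>a\<close> in
    \<open>D\<close> appear as a column of matrix \<open>l0\<close>; injectivity of \<open>f\<close>
    leaves each used row with a single entry 1.\<close>
  ultimately obtain S where S: "{l0} \<times> D \<subseteq> S" "S \<subseteq> UNIV \<times> D" "card S = card D'"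
    using exists_subset_between[of "{l0} \<times> D" "card D'" "UNIV \<times> D"] fin by auto
  have "finite S" using S(2) fin(1) finite_subset by (metis finite finite_cartesian_product)
  then obtain f where f: "bij_betw f D' S" using fin(2) S(3) by (metis finite_same_card_bij)
  have inj: "b' = b" if "f b' = f b" "b \<in> D'" "b' \<in> D'" for b b'
    using f that by (auto simp: bij_betw_def inj_on_def)
  define E where "E l a b \<longleftrightarrow> b \<in> D' \<and> f b = (l, a)" for l a b
  have "a \<in> D \<and> b \<in> D'" if "E l a b" for l a b
  proof -
    have "b \<in> D'" using that by (simp add: E_def)
    then have "f b \<in> S" using f unfolding bij_betw_def by blast
    then show ?thesis using that S(2) by (auto simp: E_def)
  qed
  moreover have "\<exists>l b. \<forall>a'. E l a' b \<longleftrightarrow> a' = a" if "a \<in> D" for a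
  proof -
    have "(l0, a) \<in> f ` D'" using that S(1) f by (auto simp: bij_betw_def)
    then obtain b where "b \<in> D'" "f b = (l0, a)" by auto
    then have "\<forall>a'. E l0 a' b \<longleftrightarrow> a' = a" by (auto simp: E_def)
    then show ?thesis by blast
  qed
  moreover have "\<exists>l a. \<forall>b'. E l a b' \<longleftrightarrow> b' = b" if "b \<in> D'" for b
  proof -
    have "\<forall>b'. E (fst (f b)) (snd (f b)) b' \<longleftrightarrow> b' = b" using that inj by (auto simp: E_def)
    then show ?thesis by blast
  qed
  ultimately have "matching_family D D' E" by (simp add: matching_family_def)
  then show ?thesis by blast
qed

lemma card_le_dim_if_axes:
  fixes S :: "('k::field ^ 'n) set"
  assumes "\<And>a. a \<in> D \<Longrightarrow> axis a 1 \<in> S"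
  shows "card D \<le> vec.dim S"
proof -
  let ?B = "(\<lambda>a. axis a (1 :: 'k)) ` D"
  have "vec.independent ?B"
    by (rule vec.independent_mono[OF independent_cart_basis]) (auto simp: cart_basis_def)
  moreover have "?B \<subseteq> S" using assms by blast
  ultimately have "card ?B \<le> vec.dim S" by (intro vec.independent_card_le_dim)
  moreover have "card ?B = card D"
    by (intro card_image) (auto simp: inj_on_def axis_eq_axis)
  ultimately show ?thesis by simp
qed

text \<open>Membership in the stratum bounds both ranks from above, and a matching family bounds
  them from below by the same numbers. Such tuples distinguish the strata.\<close>

lemma rank_stratum_generic:
  assumes k: "k \<le> CARD('n)" and le: "k \<le> CARD('r) * (CARD('n) - k)" "CARD('n) - k \<le> CARD('r) * k"
  shows "\<exists>A :: ('k::field, 'n::finite, 'r::finite) matrix_tuple.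
    A \<in> rank_stratum k \<and> col_rank A = k \<and> row_rank A = CARD('n) - k"
proof -
  obtain D :: "'n set" where D: "card D = k" using k by (metis obtain_subset_with_card_n)
  have D': "card (- D) = CARD('n) - k" by (simp add: Compl_eq_Diff_UNIV card_Diff_subset D)
  have "\<exists>E :: 'r \<Rightarrow> 'n \<Rightarrow> 'n \<Rightarrow> bool. matching_family D (- D) E"
  proof (cases "card D \<le> card (- D)")
    case True
    then show ?thesis using le(2) by (intro exists_matching_family) (simp_all only: D D' finite)
  next
    case False
    \<comment> \<open>The construction needs the smaller set first, so it is applied with the two
      sets exchanged.\<close>
    then have "card (- D) \<le> card D" "card D \<le> CARD('r) * card (- D)" using le(1) D D' by simp_all
    then have "\<exists>E :: 'r \<Rightarrow> 'n \<Rightarrow> 'n \<Rightarrow> bool. matching_family (- D) D E"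
      by (intro exists_matching_family) (simp_all only: finite)
    then show ?thesis using matching_family_swap by metis
  qed
  then obtain E :: "'r \<Rightarrow> 'n \<Rightarrow> 'n \<Rightarrow> bool" where E: "matching_family D (- D) E" by blast
  define A :: "('k, 'n, 'r) matrix_tuple" where "A = (\<chi> l a b. if E l a b then 1 else 0)"
  have "block_supported D A" using E by (auto simp: block_supported_def A_def matching_family_def)
  then have "A \<in> rank_stratum k"
    using rank_stratumI[of D A "mat 1" "mat 1" 1] D by simp
  moreover have "card D \<le> col_rank A"
    unfolding col_rank_def
  proof (rule card_le_dim_if_axes)
    fix a assume "a \<in> D"
    then obtain l b where "\<forall>a'. E l a' b \<longleftrightarrow> a' = a"
      using E unfolding matching_family_def by blast
    then have "axis a 1 = column b (A $ l)" by (simp add: vec_eq_iff A_def column_def axis_def)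
    then show "axis a 1 \<in> range (\<lambda>(l, j). column j (A $ l))" by (intro image_eqI[of _ _ "(l, b)"]) simp_all
  qed
  moreover have "card (- D) \<le> row_rank A"
    unfolding row_rank_def
  proof (rule card_le_dim_if_axes)
    fix b assume "b \<in> - D"
    then obtain l a where "\<forall>b'. E l a b' \<longleftrightarrow> b' = b"
      using E unfolding matching_family_def by blast
    then have "axis b 1 = row a (A $ l)" by (simp add: vec_eq_iff A_def row_def axis_def)
    then show "axis b 1 \<in> range (\<lambda>(l, i). row i (A $ l))" by (intro image_eqI[of _ _ "(l, a)"]) simp_all
  qed
  ultimately show ?thesis unfolding D D' rank_stratum_def by (intro exI[of _ A]) auto
qed

section \<open>Covering by strata and the count\<close>

lemma Rep_subset_Union_rank_stratum:
  fixes A :: "('k::field, 'n::finite, 'r::finite) matrix_tuple"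
  assumes m: "\<And>k. CARD('n) \<le> (CARD('r) + 1) * k \<Longrightarrow> m \<le> k" and le: "2 * m \<le> CARD('n)"
    and A: "A \<in> Rep"
  shows "\<exists>k\<in>{m..CARD('n) - m}. A \<in> rank_stratum k"
proof -
  let ?d = "CARD('n)" and ?r = "CARD('r)"
  have sum: "col_rank A + row_rank A \<le> ?d" by (rule col_rank_add_row_rank_le[OF A])
  \<comment> \<open>Adding \<open>?d - col_rank A\<close> to both sides gives
    \<open>?d \<le> (?r + 1) * (?d - col_rank A)\<close>, which is the premise of
    \<open>m\<close>.\<close>
  have "col_rank A \<le> ?r * (?d - col_rank A)"
    using col_rank_le_mult_row_rank[of A] sum mult_le_mono2[of "row_rank A" "?d - col_rank A" ?r]
    by linarith
  then have 1: "m \<le> ?d - col_rank A" using sum by (intro m) simp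
  have "row_rank A \<le> ?r * (?d - row_rank A)"
    using row_rank_le_mult_col_rank[of A] sum mult_le_mono2[of "col_rank A" "?d - row_rank A" ?r]
    by linarith
  then have 2: "m \<le> ?d - row_rank A" using sum by (intro m) simp
  \<comment> \<open>The natural index \<open>col_rank A\<close> may lie below \<open>m\<close>;
    raising it to \<open>m\<close> is allowed because
    \<open>row_rank A \<le> ?d - m\<close>.\<close>
  have "A \<in> rank_stratum (max (col_rank A) m)"
    using sum 1 2 A le by (auto simp: rank_stratum_def max_def)
  moreover have "max (col_rank A) m \<in> {m..?d - m}" using 1 le sum by auto
  ultimately show ?thesis by blast
qed

theorem corollary3p13:
  fixes r d :: nat
  assumes "CARD('r::finite) = r" and "r \<ge> 2"
    and "CARD('n::finite) = d" and "d \<ge> 2"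
  shows "let comps = irreducible_components
           (subtopology zariski (Rep :: ('k::alg_closed_field, 'n, 'r) matrix_tuple set))
         in finite comps \<and> int (card comps) = int d - 2 * \<lceil>real d / real (r + 1)\<rceil> + 1"
proof -
  define m where "m = nat \<lceil>real d / real (r + 1)\<rceil>"
  have m_le_iff: "m \<le> k \<longleftrightarrow> d \<le> (r + 1) * k" for k
  proof -
    have "m \<le> k \<longleftrightarrow> real d / real (r + 1) \<le> real k" by (simp add: m_def nat_le_iff ceiling_le_iff)
    also have "\<dots> \<longleftrightarrow> real d \<le> real ((r + 1) * k)" by (simp add: divide_le_eq algebra_simps)
    finally show ?thesis by (simp only: of_nat_le_iff)
  qed
  have m2: "2 * m \<le> d"
  proof -
    \<comment> \<open>Since \<open>r + 1\<close> is at least 3, the bound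
      \<open>m \<le> d div 2\<close> follows; the inequality would fail for
      \<open>d = 1\<close>.\<close>
    have "d \<le> 3 * (d div 2)" using \<open>d \<ge> 2\<close> by presburger
    also have "\<dots> \<le> (r + 1) * (d div 2)" using \<open>r \<ge> 2\<close> by (intro mult_right_mono) auto
    finally show ?thesis using m_le_iff[of "d div 2"] by linarith
  qed
  let ?R = "Rep :: ('k, 'n, 'r) matrix_tuple set"
  let ?S = "rank_stratum :: nat \<Rightarrow> ('k, 'n, 'r) matrix_tuple set"
  let ?C = "?S ` {m..d - m}"
  have S_sub: "?S k \<subseteq> ?R" for k by (auto simp: rank_stratum_def)
  have subset_imp_eq: "k = k'" if k: "k \<in> {m..d - m}" and k': "k' \<in> {m..d - m}" and sub: "?S k \<subseteq> ?S k'" for k k'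
  proof -
    \<comment> \<open>Both \<open>k\<close> and \<open>d - k\<close> are at least \<open>m\<close>,
      which yields exactly the inequalities required for a tuple of ranks \<open>k\<close> and
      \<open>d - k\<close>. Its membership in the other stratum compares the indices in both
      directions.\<close>
    have "d \<le> (r + 1) * k" "d \<le> (r + 1) * (d - k)"
      using k m2 m_le_iff[of k] m_le_iff[of "d - k"] by auto
    then have "k \<le> CARD('n)" "k \<le> CARD('r) * (CARD('n) - k)" "CARD('n) - k \<le> CARD('r) * k"
      using k assms(1,3) by auto
    then obtain A :: "('k, 'n, 'r) matrix_tuple" where A: "A \<in> rank_stratum k" "col_rank A = k" "row_rank A = d - k"
      using rank_stratum_generic[of k] assms(3) by blast
    then have "k \<le> k'" "d - k \<le> d - k'" using sub assms(3) by (auto simp: rank_stratum_def)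
    then show ?thesis using k k' m2 by auto
  qed
  have "irreducible_components (subtopology zariski ?R) = ?C"
  proof (rule irreducible_components_eqI)
    show "finite ?C" by simp
    have "\<exists>k\<in>{m..d - m}. A \<in> ?S k" if "A \<in> ?R" for A
      using Rep_subset_Union_rank_stratum[of m A] that m2 m_le_iff assms(1,3) by blast
    then show "\<Union>?C = topspace (subtopology zariski ?R)" using S_sub by auto
  next
    fix C assume "C \<in> ?C"
    then obtain k where k: "k \<in> {m..d - m}" "C = ?S k" by blast
    show "closedin (subtopology zariski ?R) C"
      unfolding k(2) by (rule closedin_subset_topspace[OF closedin_rank_stratum S_sub])
    obtain D :: "'n set" where "card D = k"
      using k(1) assms(3) by (meson atLeastAtMost_iff diff_le_self le_trans obtain_subset_with_card_n)
    then show "irreducible_in (subtopology zariski ?R) C"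
      using irreducible_rank_stratum[OF infinite_UNIV_alg_closed, of D] S_sub k(2)
      by (auto intro: irreducible_in_subtopology)
  next
    fix C C' assume "C \<in> ?C" "C' \<in> ?C" "C \<subseteq> C'"
    then show "C = C'" using subset_imp_eq by blast
  qed
  moreover have "inj_on ?S {m..d - m}" using subset_imp_eq by (intro inj_onI) blast
  then have "card ?C = d - m + 1 - m" by (simp add: card_image)
  \<comment> \<open>The bound \<open>2 * m \<le> d\<close> keeps the truncated subtraction
    exact.\<close>
  then have "int (card ?C) = int d - 2 * int m + 1" using m2 by linarith
  \<comment> \<open>A value above -1 has a nonnegative ceiling, so \<open>nat\<close> in the
    definition of \<open>m\<close> loses nothing.\<close>
  moreover have "- 1 < real d / real (r + 1)" by (rule less_le_trans[of _ 0]) simp_all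
  then have "int m = \<lceil>real d / real (r + 1)\<rceil>" by (simp add: m_def)
  ultimately show ?thesis by simp
qed

end
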